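(* There is a bounded McShane integrable function $\phi:[0,1]\to\ell^\infty(\mathfrak c)$ which is not properly measurable and therefore not Talagrand integrable.
   Context: $\mathfrak c$ is the cardinal of the continuum and $\ell^\infty(\mathfrak c)$ is the Banach space of bounded real-valued functions on $\mathfrak c$ with the supremum norm. $\mu$ is Lebesgue measure on $[0,1]$. $X^*$ is the dual of a (real) Banach space $X$. Intervals are non-overlapping if their interiors are pairwise disjoint. McShane integral: A McShane partition of $[0,1]$ is a finite sequence $\langle([a_i,b_i],t_i)\rangle_{i\le n}$ such that $\langle[a_i,b_i]\rangle_{i\le n}$ is a non-overlapping family of closed intervals covering $[0,1]$ (i.e. with union $[0,1]$) and $t_i\in[0,1]$ for each $i$ (it is not required that $t_i\in[a_i,b_i]$). A gauge on $[0,1]$ is a function $\delta:[0,1]\to(0,\infty)$. The partition is subordinate to $\delta$ if $t_i-\delta(t_i)\le a_i\le b_i\le t_i+\delta(t_i)$ for every $i\le n$. A function $\phi:[0,1]\to X$ is McShane integrable, with McShane integral $w\in X$, if for every $\epsilon>0$ there is a gauge $\delta$ such that $\|w-\sum_{i\le n}(b_i-a_i)\phi(t_i)\|\le\epsilon$ for every McShane partition $\langle([a_i,b_i],t_i)\rangle_{i\le n}$ of $[0,1]$ subordinate to $\delta$. Stable sets and proper measurability: Let $(S,\Sigma,\mu)$ be a probability space. For $A\subseteq\mathbb R^S$, $E\in\Sigma$, integers $m,n\ge1$ and reals $\alpha<\beta$, let $Z(A,E,m,n,\alpha,\beta)$ be the set of $(t,u)\in E^m\times E^n$ for which there is $f\in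 A$ with $f(t(i))\le\alpha$ for all $i<m$ and $f(u(j))\ge\beta$ for all $j<n$. $A$ is stable if for every $E\in\Sigma$ with $\mu E>0$ and all reals $\alpha<\beta$ there are $m,n\ge1$ with $\mu^*_{m+n}Z(A,E,m,n,\alpha,\beta)<(\mu E)^{m+n}$, where $\mu^*_{m+n}$ is the outer measure of the product measure on $S^m\times S^n$. A function $\phi:S\to X$ is properly measurable if $\{h\circ\phi:h\in X^*,\ \|h\|\le1\}$ is stable. Here $S=[0,1]$ with Lebesgue measure. Talagrand integral: $\phi:[0,1]\to X$ is Talagrand integrable, with Talagrand integral $w\in X$, if $w=\lim_{n\to\infty}\frac1n\sum_{i<n}\phi(s_i)$ (norm limit) for almost all sequences $\langle s_i\rangle_{i\in\mathbb N}\in[0,1]^{\mathbb N}$, where $[0,1]^{\mathbb N}$ is given its product probability measure. *)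

theory Defs
  imports "HOL-Probability.Probability"
begin

text \<open>
  On a discrete space every function is continuous, so bounded continuous functions on the
  discrete copy of the reals (an index set of cardinality continuum), with their supremum norm,
  are exactly the Banach space $\ell^\infty(\mathfrak c)$.
\<close>

type_synonym linf_continuum = "real discrete \<Rightarrow>\<^sub>C real"

text \<open>
  Functions on the unit interval are total functions on the reals; all notions below
  depend only on their values on \<open>{0..1}\<close>.
\<close>

definition mcshane_partition :: "(real \<times> real \<times> real) list \<Rightarrow> bool" where
  "mcshane_partition p \<longleftrightarrow>
     (\<forall>(a, b, t) \<in> set p. a \<le> b \<and> t \<in> {0..1}) \<and>
     (\<forall>i < length p. \<forall>j < length p. i \<noteq> j \<longrightarrow>
        (case p ! i of (a, b, _) \<Rightarrow> case p ! j of (c, d, _) \<Rightarrow>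
           interior {a..b} \<inter> interior {c..d} = {})) \<and>
     (\<Union>(a, b, t) \<in> set p. {a..b}) = {0..1}"

definition mcshane_gauge :: "(real \<Rightarrow> real) \<Rightarrow> bool" where
  "mcshane_gauge \<delta> \<longleftrightarrow> (\<forall>t \<in> {0..1}. \<delta> t > 0)"

definition subordinate :: "(real \<times> real \<times> real) list \<Rightarrow> (real \<Rightarrow> real) \<Rightarrow> bool" where
  "subordinate p \<delta> \<longleftrightarrow> (\<forall>(a, b, t) \<in> set p. t - \<delta> t \<le> a \<and> a \<le> b \<and> b \<le> t + \<delta> t)"

definition has_mcshane_integral :: "(real \<Rightarrow> 'b::real_normed_vector) \<Rightarrow> 'b \<Rightarrow> bool" where
  "has_mcshane_integral \<phi> w \<longleftrightarrow>
     (\<forall>\<epsilon>>0. \<exists>\<delta>. mcshane_gauge \<delta> \<and>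
        (\<forall>p. mcshane_partition p \<and> subordinate p \<delta> \<longrightarrow>
           norm (w - (\<Sum>(a, b, t) \<leftarrow> p. (b - a) *\<^sub>R \<phi> t)) \<le> \<epsilon>))"

definition mcshane_integrable :: "(real \<Rightarrow> 'b::real_normed_vector) \<Rightarrow> bool" where
  "mcshane_integrable \<phi> \<longleftrightarrow> (\<exists>w. has_mcshane_integral \<phi> w)"

definition Zset :: "('a \<Rightarrow> real) set \<Rightarrow> 'a set \<Rightarrow> nat \<Rightarrow> nat \<Rightarrow> real \<Rightarrow> real
    \<Rightarrow> ((nat \<Rightarrow> 'a) \<times> (nat \<Rightarrow> 'a)) set" where
  "Zset A E m n \<alpha> \<beta> =
     {(t, u) \<in> ({..<m} \<rightarrow>\<^sub>E E) \<times> ({..<n} \<rightarrow>\<^sub>E E).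
        \<exists>f \<in> A. (\<forall>i<m. f (t i) \<le> \<alpha>) \<and> (\<forall>j<n. f (u j) \<ge> \<beta>)}"

text \<open>
  The product measures here are not completed; this does not matter, since a measure
  and its completion have the same outer measure.
\<close>

definition stable :: "'a measure \<Rightarrow> ('a \<Rightarrow> real) set \<Rightarrow> bool" where
  "stable M A \<longleftrightarrow>
     (\<forall>E \<in> sets M. emeasure M E > 0 \<longrightarrow>
        (\<forall>\<alpha> \<beta>. \<alpha> < \<beta> \<longrightarrow>
           (\<exists>m\<ge>1. \<exists>n\<ge>1.
              outer_measure_of (PiM {..<m} (\<lambda>_. M) \<Otimes>\<^sub>M PiM {..<n} (\<lambda>_. M))
                (Zset A E m n \<alpha> \<beta>) < emeasure M E ^ (m + n))))"

definition properly_measurable :: "'a measure \<Rightarrow> ('a \<Rightarrow> 'b::real_normed_vector) \<Rightarrow> bool" where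
  "properly_measurable M \<phi> \<longleftrightarrow>
     stable M {blinfun_apply h \<circ> \<phi> | h :: 'b \<Rightarrow>\<^sub>L real. norm h \<le> 1}"

definition has_talagrand_integral :: "(real \<Rightarrow> 'b::real_normed_vector) \<Rightarrow> 'b \<Rightarrow> bool" where
  "has_talagrand_integral \<phi> w \<longleftrightarrow>
     (AE s in PiM (UNIV :: nat set) (\<lambda>_. lebesgue_on {0..1}).
        (\<lambda>n. (1 / real n) *\<^sub>R (\<Sum>i<n. \<phi> (s i))) \<longlonglongrightarrow> w)"

definition talagrand_integrable :: "(real \<Rightarrow> 'b::real_normed_vector) \<Rightarrow> bool" where
  "talagrand_integrable \<phi> \<longleftrightarrow> (\<exists>w. has_talagrand_integral \<phi> w)"

end

theory Submission
  imports Defs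
begin

text \<open>
  Enumerate by reals the compact subsets of the sequence space \<open>[0,1]\<^sup>\<nat>\<close> of positive product measure
  and choose, by transfinite recursion, a sequence \<open>u \<xi>\<close> in the \<open>\<xi>\<close>-th set whose terms differ from
  all terms of earlier sequences.  Let \<open>\<phi> t\<close> be the indicator of the (at most one) \<open>\<xi>\<close> for which \<open>t\<close>
  is a term of \<open>u \<xi>\<close>.  Since the ranges are disjoint, a single gauge can give the \<open>k\<close>-th term of every
  sequence the radius \<open>\<epsilon> / 2\<^sup>k\<^sup>+\<^sup>2\<close>; so the McShane integral is 0, uniformly in the coordinate.
  On the other hand the sequences \<open>u \<xi>\<close> form a set of full outer measure.  Along \<open>u \<xi>\<close> all averages
  of \<open>\<phi>\<close> have \<open>\<xi>\<close>-coordinate 1, whereas a Talagrand integral would have to be 0; and the sets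
  \<open>range (u \<xi>)\<close> separate almost all pairs of tuples in the outer-measure sense, which refutes stability.
\<close>

section \<open>Cardinalities and transfinite selection\<close>

text \<open>A compact subset of positive measure already has continuum many points, because its
  distribution function maps it onto a set containing an interval. This will count rotation
  angles.\<close>

lemma emeasure_pos_real_continuum:
  fixes T :: "real set"
  assumes T: "T \<in> sets borel" and pos: "0 < emeasure lborel T"
  shows "(UNIV :: real set) \<lesssim> T"
proof -
  have "\<exists>n::nat. 0 < emeasure lborel (T \<inter> {-real n..real n})"
  proof (rule ccontr)
    assume "\<not> ?thesis"
    then have "emeasure lborel (\<Union>n. T \<inter> {-real n..real n}) = 0"
      by (intro emeasure_UN_eq_0) (use T in auto)
    moreover have "(\<Union>n. T \<inter> {-real n..real n}) = T"
    proof -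
      have "\<exists>n. - real n \<le> x \<and> x \<le> real n" for x
        using real_arch_simple[of "\<bar>x\<bar>"] by (auto simp: abs_le_iff minus_le_iff)
      then show ?thesis by auto
    qed
    ultimately show False using pos by simp
  qed
  then obtain n :: nat where n: "0 < emeasure lborel (T \<inter> {-real n..real n})" by blast
  \<comment> \<open>Cutting Lebesgue measure down to a bounded interval makes it finite, as inner
    regularity requires.\<close>
  let ?D = "density lborel (indicator {-real n..real n})"
  have D: "emeasure ?D A = emeasure lborel (A \<inter> {-real n..real n})" if "A \<in> sets borel" for A
    using that by (subst emeasure_density) (auto simp: mult_ac Int_def indicator_inter_arith[symmetric] nn_integral_indicator[symmetric] simp del: nn_integral_indicator)
  have "emeasure ?D T = (SUP K \<in> {K. K \<subseteq> T \<and> compact K}. emeasure ?D K)"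
    using T by (intro inner_regular) (auto simp: D)
  then obtain C where C: "C \<subseteq> T" "compact C" "0 < emeasure ?D C"
    using n D[OF T] by (auto simp: less_SUP_iff)
  \<comment> \<open>\<open>F\<close> is continuous and constant on the gaps of \<open>C\<close>, so it takes all its values on \<open>C\<close>.\<close>
  define F where "F x = measure lborel (C \<inter> {..x})" for x
  have CB [simp]: "C \<in> sets borel" using C(2) by (simp add: compact_imp_closed)
  have fin [simp]: "C \<inter> A \<in> fmeasurable lborel" if "A \<in> sets borel" for A
    using C(2) that
    by (intro fmeasurableI2[of "C" _ "C \<inter> A"]) (auto simp: fmeasurable_compact compact_imp_closed)
  have lip: "F x \<le> F y \<and> F y \<le> F x + (y - x)" if "x \<le> y" for x y
  proof -
    have "F y \<le> measure lborel ((C \<inter> {..x}) \<union> {x..y})"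
      unfolding F_def using C(2) by (intro measure_mono_fmeasurable fmeasurable.Un fin) (auto simp: compact_imp_closed intro!: fmeasurable_compact)
    also have "\<dots> \<le> F x + (y - x)"
      unfolding F_def using that by (intro order_trans[OF measure_Un_le]) auto
    finally show ?thesis
      unfolding F_def using that by (auto intro!: measure_mono_fmeasurable)
  qed
  have cont: "continuous_on S F" for S
  proof (rule continuous_on_subset)
    show "continuous_on UNIV F"
      unfolding continuous_on_iff
    proof safe
      fix x e :: real assume "0 < e"
      moreover have "dist (F y) (F x) \<le> dist y x" for y
        using lip[of x y] lip[of y x] by (auto simp: dist_real_def abs_if)
      ultimately show "\<exists>d>0. \<forall>x'\<in>UNIV. dist x' x < d \<longrightarrow> dist (F x') (F x) < e"
        by (meson le_less_trans)
    qed
  qed auto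
  obtain a b where ab: "C \<subseteq> {a..b}"
    using C(2) compact_imp_bounded bounded_subset_cbox_symmetric[of C] by (metis cbox_interval)
  define m where "m = measure lborel C"
  have m: "0 < m"
  proof -
    have "0 < emeasure lborel (C \<inter> {-real n..real n})"
      using C(2,3) D[of C] by (auto simp: compact_imp_closed)
    also have "\<dots> \<le> emeasure lborel C"
      using C(2) by (intro emeasure_mono) (auto simp: compact_imp_closed)
    finally show ?thesis
      using fin[of UNIV] unfolding m_def by (auto simp: emeasure_eq_measure2)
  qed
  have "C \<noteq> {}" using m by (auto simp: m_def)
  have sub: "{0<..<m} \<subseteq> F ` C"
  proof
    fix y assume y: "y \<in> {0<..<m}"
    \<comment> \<open>Starting at \<open>a - 1\<close> keeps the intersection empty even when
      \<open>a\<close> belongs to \<open>C\<close>.\<close>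
    have "C \<inter> {..a-1} = {}" "C \<inter> {..b} = C" using ab by auto
    then have "F (a - 1) = 0" "F b = m" by (simp_all add: F_def m_def)
    moreover have "a \<le> b" using ab \<open>C \<noteq> {}\<close> by auto
    ultimately obtain x where x: "F x = y"
      using IVT'[of F "a - 1" y b, OF _ _ _ cont] y by auto
    have ne: "C \<inter> {..x} \<noteq> {}" using x y by (auto simp: F_def)
    have "compact (C \<inter> {..x})" using C(2) by (intro compact_Int_closed) auto
    then obtain z where z: "z \<in> C \<inter> {..x}" "\<And>w. w \<in> C \<inter> {..x} \<Longrightarrow> w \<le> z"
      using compact_attains_sup[OF _ ne] by auto
    then have "C \<inter> {..z} = C \<inter> {..x}" by force
    then show "y \<in> F ` C" using z(1) x by (auto simp: F_def intro!: image_eqI[of _ _ z])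
  qed
  have "(UNIV :: real set) \<lesssim> {0<..<m}"
    using eqpoll_real_subset[of 0 m "{0<..<m}"] m eqpoll_imp_lepoll eqpoll_sym by auto
  also have "{0<..<m} \<lesssim> F ` C" by (rule subset_imp_lepoll[OF sub])
  also have "F ` C \<lesssim> C" by (rule image_lepoll)
  also have "C \<lesssim> T" by (rule subset_imp_lepoll[OF C(1)])
  finally show ?thesis .
qed

text \<open>The union has at most max(|J|, aleph_0) elements, and both cardinals lie below the
  continuum.\<close>

lemma card_of_UN_countable_ordLess_continuum:
  includes cardinal_syntax
  fixes C :: "'a \<Rightarrow> 'b set"
  assumes J: "|J| <o |UNIV :: real set|" and C: "\<And>j. j \<in> J \<Longrightarrow> countable (C j)"
  shows "|\<Union>j\<in>J. C j| <o |UNIV :: real set|"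
proof -
  have nat: "|UNIV :: nat set| <o |UNIV :: real set|"
  proof -
    have "\<not> |UNIV :: real set| \<le>o |UNIV :: nat set|"
    proof
      assume "|UNIV :: real set| \<le>o |UNIV :: nat set|"
      then have "\<exists>f :: real \<Rightarrow> nat. inj_on f UNIV \<and> f ` UNIV \<subseteq> UNIV"
        by (rule card_of_ordLeq[THEN iffD2])
      then have "countable (UNIV :: real set)" unfolding countable_def by blast
      then show False using uncountable_UNIV_real by contradiction
    qed
    then show ?thesis by (simp only: not_ordLeq_iff_ordLess card_of_Well_order)
  qed
  \<comment> \<open>Adjoining the naturals gives an infinite bound even when \<open>J\<close> is
    finite.\<close>
  let ?B = "J <+> (UNIV :: nat set)"
  have "|\<Union>j\<in>J. C j| \<le>o |?B|"
  proof (rule card_of_UNION_ordLeq_infinite)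
    show "infinite ?B" by (simp add: finite_Plus_iff)
    show "|J| \<le>o |?B|" by (rule card_of_Plus1)
    show "\<forall>j\<in>J. |C j| \<le>o |?B|"
    proof
      fix j assume "j \<in> J"
      then obtain g :: "'b \<Rightarrow> nat" where "inj_on g (C j)" using C unfolding countable_def by blast
      then have "|C j| \<le>o |UNIV :: nat set|" by (rule card_of_ordLeqI) simp
      then show "|C j| \<le>o |?B|" by (rule ordLeq_transitive[OF _ card_of_Plus2])
    qed
  qed
  moreover have "|?B| <o |UNIV :: real set|"
    using infinite_UNIV_char_0 J nat by (rule card_of_Plus_ordLess_infinite)
  ultimately show ?thesis by (rule ordLeq_ordLess_trans)
qed

text \<open>At each stage fewer than continuum many sequences have been chosen, so their terms form
  a set that \<open>avoid\<close> allows the next sequence to miss.\<close>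

lemma transfinite_disjoint_selection:
  includes cardinal_syntax
  fixes K :: "real \<Rightarrow> (nat \<Rightarrow> 'a) set"
  assumes avoid: "\<And>\<xi> P. |P| <o |UNIV :: real set| \<Longrightarrow> \<exists>v\<in>K \<xi>. range v \<inter> P = {}"
  obtains u where "\<And>\<xi>. u \<xi> \<in> K \<xi>" "\<And>\<xi> \<eta>. \<xi> \<noteq> \<eta> \<Longrightarrow> range (u \<xi>) \<inter> range (u \<eta>) = {}"
proof -
  \<comment> \<open>As a relation, this cardinal is a well-order of the reals of least order type,
    so every proper initial segment is smaller than the continuum.\<close>
  let ?r = "|UNIV :: real set|"
  have wo: "wo_rel ?r" by (simp add: wo_rel_def card_of_Well_order)
  have wf: "wf (?r - Id)" by (rule wo_rel.WF[OF wo])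
  define F where "F = (\<lambda>(f :: real \<Rightarrow> nat \<Rightarrow> 'a) \<xi>. SOME v. v \<in> K \<xi> \<and> range v \<inter> (\<Union>\<eta>\<in>underS ?r \<xi>. range (f \<eta>)) = {})"
  define u where "u = wfrec (?r - Id) F"
  have u: "u \<xi> \<in> K \<xi> \<and> range (u \<xi>) \<inter> (\<Union>\<eta>\<in>underS ?r \<xi>. range (u \<eta>)) = {}" for \<xi>
  proof -
    let ?P = "\<Union>\<eta>\<in>underS ?r \<xi>. range (u \<eta>)"
    \<comment> \<open>The recursion only looks at predecessors of \<open>\<xi>\<close>, where
      \<open>cut\<close> leaves \<open>u\<close> unchanged.\<close>
    have P: "(\<Union>\<eta>\<in>underS ?r \<xi>. range (cut u (?r - Id) \<xi> \<eta>)) = ?P"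
      by (rule SUP_cong) (auto simp only: underS_def cut_def mem_Collect_eq Diff_iff pair_in_Id_conv if_True split: if_splits)
    have eq: "u \<xi> = (SOME v. v \<in> K \<xi> \<and> range v \<inter> ?P = {})"
    proof -
      have "u \<xi> = F (cut u (?r - Id) \<xi>) \<xi>"
        unfolding u_def by (rule wfrec[OF wf])
      then show ?thesis unfolding F_def P .
    qed
    have "|underS ?r \<xi>| <o ?r"
      by (rule card_of_underS) (simp_all only: card_of_card_order_on Field_card_of UNIV_I card_of_Card_order)
    then have "|?P| <o ?r"
      by (rule card_of_UN_countable_ordLess_continuum) simp
    then have "\<exists>v. v \<in> K \<xi> \<and> range v \<inter> ?P = {}"
      using avoid[of ?P \<xi>] by blast
    then show ?thesis
      unfolding eq by (rule someI_ex)
  qed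
  have "range (u \<xi>) \<inter> range (u \<eta>) = {}" if "\<xi> \<noteq> \<eta>" for \<xi> \<eta>
  proof -
    have "(\<xi>, \<eta>) \<in> ?r \<or> (\<eta>, \<xi>) \<in> ?r"
      using wo_rel.TOTALS[OF wo] by (simp only: Field_card_of) blast
    then have "\<xi> \<in> underS ?r \<eta> \<or> \<eta> \<in> underS ?r \<xi>"
      using that unfolding underS_def by blast
    then show ?thesis using u[of \<xi>] u[of \<eta>] by blast
  qed
  with u show ?thesis by (intro that[of u]) blast+
qed

text \<open>A closed set is determined by the members of a countable base that miss it, hence by a
  set of naturals.\<close>

lemma closed_sets_lepoll_reals:
  "{K :: 'a :: second_countable_topology set. closed K} \<lesssim> (UNIV :: real set)"
proof -
  obtain B :: "'a set set" where B: "countable B" "topological_basis B"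
    using ex_countable_basis by blast
  then have "B \<noteq> {}"
    by (metis Sup_bot_conv(2) UNIV_I empty_iff open_UNIV subset_empty topological_basis_def)
  then have rB: "range (from_nat_into B) = B" using B(1) by (rule range_from_nat_into)
  let ?f = "\<lambda>K. {n. from_nat_into B n \<subseteq> - K}"
  have "inj_on ?f {K. closed K}"
  proof (rule inj_onI)
    have eq: "- K = \<Union>(from_nat_into B ` ?f K)" if "closed K" for K :: "'a set"
    proof -
      have "- K = \<Union>{X \<in> B. X \<subseteq> - K}"
      proof (intro equalityI subsetI)
        fix x assume "x \<in> - K"
        with that obtain X where "X \<in> B" "x \<in> X" "X \<subseteq> - K"
          using topological_basisE[OF B(2), of "- K" x] by (metis open_Compl)
        then show "x \<in> \<Union>{X \<in> B. X \<subseteq> - K}" by blast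
      qed blast
      also have "{X \<in> B. X \<subseteq> - K} = from_nat_into B ` ?f K"
        using rB by (auto simp: image_iff) (metis rangeE)
      finally show ?thesis .
    qed
    fix K L :: "'a set" assume "K \<in> {K. closed K}" "L \<in> {K. closed K}" "?f K = ?f L"
    then have "- K = - L" using eq[of K] eq[of L] by simp
    then show "K = L" by simp
  qed
  then have "{K :: 'a set. closed K} \<lesssim> (UNIV :: nat set set)" unfolding lepoll_def by blast
  also have "\<dots> \<lesssim> (UNIV :: real set)" using nat_sets_eqpoll_reals by (rule eqpoll_imp_lepoll)
  finally show ?thesis .
qed

section \<open>Product measures and rotation of the unit interval\<close>

text \<open>A product measure is determined by its values on cylinders, and these agree. Used both
  for rotating all coordinates at once and for passing from Lebesgue to Borel sets.\<close>

lemma distr_PiM_map: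
  assumes M: "prob_space M" and f: "f \<in> M \<rightarrow>\<^sub>M N"
  shows "distr (PiM UNIV (\<lambda>_. M)) (PiM UNIV (\<lambda>_. N)) (\<lambda>x i. f (x i)) = PiM UNIV (\<lambda>_. distr M N f)"
proof -
  interpret M: prob_space M by fact
  interpret D: prob_space "distr M N f" using f by (rule M.prob_space_distr)
  interpret Q: product_prob_space "\<lambda>_. M" UNIV ..
  interpret P: product_prob_space "\<lambda>_. distr M N f" UNIV ..
  have meas: "(\<lambda>x i. f (x i)) \<in> PiM UNIV (\<lambda>_. M) \<rightarrow>\<^sub>M PiM UNIV (\<lambda>_. N)"
    using f by (intro measurable_PiM_single' measurable_compose[OF _ f] measurable_component_singleton)
      (auto simp: space_PiM PiE_iff dest: measurable_space)
  show ?thesis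
  proof (rule P.PiM_eq)
    show "sets (distr (PiM UNIV (\<lambda>_. M)) (PiM UNIV (\<lambda>_. N)) (\<lambda>x i. f (x i))) = sets (PiM UNIV (\<lambda>_. distr M N f))"
      by (simp cong: sets_PiM_cong)
    fix J :: "'c set" and F assume J: "finite J" "\<And>j. j \<in> J \<Longrightarrow> F j \<in> sets (distr M N f)"
    let ?E = "prod_emb UNIV (\<lambda>_. distr M N f) J (Pi\<^sub>E J F)"
    have E: "?E = {x \<in> space (PiM UNIV (\<lambda>_. N)). \<forall>j\<in>J. x j \<in> F j}"
      by (auto simp: prod_emb_def space_PiM PiE_iff)
    have "?E \<in> sets (PiM UNIV (\<lambda>_. N))"
      unfolding E using J by measurable
    then have "emeasure (distr (PiM UNIV (\<lambda>_. M)) (PiM UNIV (\<lambda>_. N)) (\<lambda>x i. f (x i))) ?E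
      = emeasure (PiM UNIV (\<lambda>_. M)) ((\<lambda>x i. f (x i)) -` ?E \<inter> space (PiM UNIV (\<lambda>_. M)))"
      by (rule emeasure_distr[OF meas])
    also have "(\<lambda>x i. f (x i)) -` ?E \<inter> space (PiM UNIV (\<lambda>_. M))
        = {x \<in> space (PiM UNIV (\<lambda>_. M)). \<forall>j\<in>J. x j \<in> f -` F j \<inter> space M}"
      unfolding E using measurable_space[OF f] by (auto simp: space_PiM PiE_iff)
    also have "emeasure (PiM UNIV (\<lambda>_. M)) \<dots> = (\<Prod>j\<in>J. emeasure M (f -` F j \<inter> space M))"
      using J f by (intro Q.emeasure_PiM_Collect) auto
    also have "\<dots> = (\<Prod>j\<in>J. emeasure (distr M N f) (F j))"
      using J f by (intro prod.cong) (auto simp: emeasure_distr)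
    finally show "emeasure (distr (PiM UNIV (\<lambda>_. M)) (PiM UNIV (\<lambda>_. N)) (\<lambda>x i. f (x i))) ?E
       = (\<Prod>j\<in>J. emeasure (distr M N f) (F j))" .
  qed
qed

text \<open>The uniform distribution as a Borel measure on the whole line. Its countable power is
  then a Borel measure on \<open>nat \<Rightarrow> real\<close>, where inner regularity by compact
  sets is available.\<close>

definition unif :: "real measure" where
  "unif = distr (lebesgue_on {0..1}) borel (\<lambda>x. x)"

text \<open>Addition modulo 1 on the unit interval. Since 1 is subtracted at most once,
  \<open>x\<close> and the result leave only two candidates for \<open>t\<close>.\<close>

definition rotate_unit :: "real \<Rightarrow> real \<Rightarrow> real" where
  "rotate_unit t x = (if x + t < 1 then x + t else x + t - 1)"

lemma prob_space_lebesgue_on_unit: "prob_space (lebesgue_on {0..1::real})"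
  by (rule prob_spaceI) (simp add: emeasure_restrict_space)

lemma sets_unif [simp, measurable_cong]: "sets unif = sets borel"
  and space_unif [simp]: "space unif = UNIV"
  by (simp_all add: unif_def)

lemma measurable_ident_lebesgue_on_borel: "(\<lambda>x. x) \<in> lebesgue_on {0..1::real} \<rightarrow>\<^sub>M borel"
  by (intro measurable_restrict_space1 measurable_completion) simp

lemma emeasure_unif:
  assumes "A \<in> sets borel"
  shows "emeasure unif A = emeasure lborel (A \<inter> {0..1})"
  using assms unfolding unif_def
  by (subst emeasure_distr[OF measurable_ident_lebesgue_on_borel])
     (simp_all add: emeasure_restrict_space Int_commute)

lemma prob_space_unif: "prob_space unif"
  unfolding unif_def
  by (intro prob_space.prob_space_distr prob_space_lebesgue_on_unit measurable_ident_lebesgue_on_borel)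

lemma rotate_unit_measurable [measurable]:
  assumes [measurable]: "f \<in> borel_measurable M" "g \<in> borel_measurable M"
  shows "(\<lambda>x. rotate_unit (f x) (g x)) \<in> borel_measurable M"
  unfolding rotate_unit_def by measurable

text \<open>Up to single points, the rotation exchanges two intervals by translations, and Lebesgue
  measure is translation invariant.\<close>

lemma distr_unif_rotate_unit:
  assumes t: "t \<in> {0..1}"
  shows "distr unif borel (rotate_unit t) = unif"
proof (rule measure_eqI)
  fix A assume "A \<in> sets (distr unif borel (rotate_unit t))"
  then have A [measurable]: "A \<in> sets borel" by simp
  have m: "rotate_unit t \<in> borel_measurable unif" "rotate_unit t \<in> borel_measurable borel" by measurable
  have transl: "emeasure lborel ((\<lambda>x. x + c) -` B) = emeasure lborel B" if "B \<in> sets borel" for c and B :: "real set"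
  proof -
    have "emeasure lborel B = emeasure (distr lborel borel ((+) c)) B"
      by (simp add: lborel_distr_plus)
    also have "\<dots> = emeasure lborel ((\<lambda>x. x + c) -` B)"
      using that by (subst emeasure_distr) (simp_all add: add.commute[of c, abs_def] add.commute)
    finally show ?thesis by simp
  qed
  have vm [measurable]: "(\<lambda>x. x + c) -` B \<in> sets borel" if "B \<in> sets borel" for c and B :: "real set"
    using measurable_sets[of "\<lambda>x. x + c" borel borel B] that by simp
  have "emeasure (distr unif borel (rotate_unit t)) A = emeasure lborel (rotate_unit t -` A \<inter> {0..1})"
    using measurable_sets[OF m(2) A] by (simp add: emeasure_distr m emeasure_unif)
  \<comment> \<open>The second piece includes the endpoint \<open>t\<close>, because
    \<open>x = 1\<close> is sent there; this null point is removed afterwards.\<close>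
  also have "\<dots> = emeasure lborel ((\<lambda>x. x + t) -` (A \<inter> {t..<1}) \<union> (\<lambda>x. x + (t - 1)) -` (A \<inter> {0..t}))"
    using t by (intro arg_cong[of _ _ "emeasure lborel"]) (auto simp: rotate_unit_def algebra_simps split: if_splits)
  also have "\<dots> = emeasure lborel ((\<lambda>x. x + t) -` (A \<inter> {t..<1})) + emeasure lborel ((\<lambda>x. x + (t - 1)) -` (A \<inter> {0..t}))"
    by (intro plus_emeasure[symmetric]) auto
  also have "\<dots> = emeasure lborel (A \<inter> {t..<1}) + emeasure lborel (A \<inter> {0..t})"
    by (simp add: transl del: vimage_Int)
  also have "emeasure lborel (A \<inter> {0..t}) = emeasure lborel (A \<inter> {0..<t})"
  proof (rule emeasure_eq_AE)
    show "AE x in lborel. x \<in> A \<inter> {0..t} \<longleftrightarrow> x \<in> A \<inter> {0..<t}"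
      using AE_lborel_singleton[of t] by eventually_elim auto
  qed auto
  also have "emeasure lborel (A \<inter> {t..<1}) + emeasure lborel (A \<inter> {0..<t}) = emeasure lborel ((A \<inter> {t..<1}) \<union> (A \<inter> {0..<t}))"
    by (intro plus_emeasure) auto
  also have "\<dots> = emeasure lborel (A \<inter> {0..1})"
  proof (rule emeasure_eq_AE)
    show "AE x in lborel. x \<in> (A \<inter> {t..<1}) \<union> (A \<inter> {0..<t}) \<longleftrightarrow> x \<in> A \<inter> {0..1}"
      using AE_lborel_singleton[of "1::real"] by eventually_elim (use t in auto)
  qed auto
  finally show "emeasure (distr unif borel (rotate_unit t)) A = emeasure unif A"
    by (simp add: emeasure_unif)
qed simp

lemma sets_PiM_unif: "sets (PiM UNIV (\<lambda>_ :: nat. unif)) = sets borel"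
  by (subst sets_PiM_equal_borel[symmetric]) (rule sets_PiM_cong, simp_all)

section \<open>Selection of the disjoint sequences\<close>

text \<open>ZFC does not prove that a set \<open>P\<close> of fewer than continuum many points is
  null, so \<open>P\<close> cannot simply be discarded by measure. Fubini over simultaneous
  rotations turns the task into a count of angles.\<close>

lemma exists_avoiding_point:
  includes cardinal_syntax
  fixes K :: "(nat \<Rightarrow> real) set" and P :: "real set"
  assumes K: "K \<in> sets borel" "0 < emeasure (PiM UNIV (\<lambda>_. unif)) K"
    and P: "|P| <o |UNIV :: real set|"
  shows "\<exists>v\<in>K. range v \<inter> P = {}"
proof -
  let ?R = "PiM UNIV (\<lambda>_ :: nat. unif)"
  interpret U: prob_space unif by (rule prob_space_unif)
  interpret R: prob_space ?R by (rule prob_space_PiM) (rule prob_space_unif)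
  interpret UR: pair_prob_space unif ?R ..
  have K' [measurable]: "K \<in> sets ?R" using K by (simp add: sets_PiM_unif)
  define h where "h = (\<lambda>(t, x :: nat \<Rightarrow> real) i. rotate_unit t (x i))"
  have h [measurable]: "h \<in> unif \<Otimes>\<^sub>M ?R \<rightarrow>\<^sub>M ?R"
    unfolding h_def split_def by (rule measurable_PiM_single') (auto intro!: measurable_component_singleton)
  define H where "H = h -` K \<inter> space (unif \<Otimes>\<^sub>M ?R)"
  have H [measurable]: "H \<in> sets (unif \<Otimes>\<^sub>M ?R)" unfolding H_def by measurable
  \<comment> \<open>Rotating every coordinate by the same \<open>t\<close> preserves the product
    measure, so integrating over \<open>t\<close> gives \<open>H\<close> the measure of
    \<open>K\<close>.\<close>
  have sec: "emeasure ?R (Pair t -` H) = emeasure ?R K" if "t \<in> {0..1}" for t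
  proof -
    have "Pair t -` H = (\<lambda>x i. rotate_unit t (x i)) -` K \<inter> space ?R"
      by (auto simp: H_def h_def space_pair_measure)
    moreover have "(\<lambda>x i. rotate_unit t (x i)) \<in> ?R \<rightarrow>\<^sub>M PiM UNIV (\<lambda>_. borel)"
      by (rule measurable_PiM_single') (auto intro!: measurable_component_singleton)
    ultimately have "emeasure ?R (Pair t -` H) = emeasure (distr ?R (PiM UNIV (\<lambda>_. borel)) (\<lambda>x i. rotate_unit t (x i))) K"
      using K by (simp add: emeasure_distr sets_PiM_equal_borel)
    also have "distr ?R (PiM UNIV (\<lambda>_. borel)) (\<lambda>x i. rotate_unit t (x i)) = ?R"
      by (subst distr_PiM_map[OF prob_space_unif]) (auto simp: distr_unif_rotate_unit[OF that])
    finally show ?thesis .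
  qed
  have "AE t in unif. t \<in> {0..1}"
    unfolding unif_def by (subst AE_distr_iff[OF measurable_ident_lebesgue_on_borel]) auto
  then have "(\<integral>\<^sup>+ t. emeasure ?R (Pair t -` H) \<partial>unif) = (\<integral>\<^sup>+ t. emeasure ?R K \<partial>unif)"
    by (intro nn_integral_cong_AE) (auto simp: sec elim: eventually_mono)
  then have pos: "0 < emeasure (unif \<Otimes>\<^sub>M ?R) H"
    using K U.emeasure_space_1 by (simp add: R.emeasure_pair_measure_alt[OF H])
  \<comment> \<open>Rotating all coordinates of a suitable \<open>x\<close> at once, the rotation stays in \<open>K\<close> for a set of
    angles of positive measure, hence for continuum many angles; each pair of a point of \<open>P\<close> and
    a coordinate excludes at most two of them.\<close>
  have "\<exists>x. 0 < emeasure unif ((\<lambda>t. (t, x)) -` H)"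
  proof (rule ccontr)
    assume "\<not> ?thesis"
    then show False using pos by (simp add: UR.emeasure_pair_measure_alt2[OF H])
  qed
  then obtain x where x: "0 < emeasure unif ((\<lambda>t. (t, x)) -` H)" by blast
  define T where "T = (\<lambda>t. (t, x)) -` H"
  have T: "T \<in> sets borel"
    using sets_Pair2[OF H, of x] by (simp add: T_def)
  then have "0 < emeasure lborel (T \<inter> {0..1})" using x by (simp add: emeasure_unif T_def)
  then have "(UNIV :: real set) \<lesssim> T \<inter> {0..1}" using T by (intro emeasure_pos_real_continuum) auto
  then obtain f :: "real \<Rightarrow> real" where "inj_on f UNIV" "range f \<subseteq> T \<inter> {0..1}"
    unfolding lepoll_def by blast
  then have T_big: "|UNIV :: real set| \<le>o |T|"
    by (intro card_of_ordLeqI[of f]) auto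
  define D where "D = (\<Union>p\<in>P. \<Union>k. {p - x k, p - x k + 1})"
  have "|D| <o |UNIV :: real set|"
    unfolding D_def by (rule card_of_UN_countable_ordLess_continuum[OF P]) simp
  then have "\<not> T \<subseteq> D"
    using T_big card_of_mono1[of T D] not_ordLess_ordLeq ordLeq_transitive by blast
  then obtain t where t: "t \<in> T" "t \<notin> D" by blast
  then have "h (t, x) \<in> K" by (auto simp: T_def H_def)
  moreover have "range (h (t, x)) \<inter> P = {}"
  proof (rule ccontr)
    assume "\<not> ?thesis"
    then obtain k where k: "rotate_unit t (x k) \<in> P" by (auto simp: h_def)
    have "t = rotate_unit t (x k) - x k \<or> t = rotate_unit t (x k) - x k + 1" by (auto simp: rotate_unit_def)
    with k have "t \<in> D" unfolding D_def by blast
    with t show False by blast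
  qed
  ultimately show ?thesis by blast
qed

lemma distr_PiM_lebesgue_on_eq_unif:
  "distr (PiM UNIV (\<lambda>_ :: nat. lebesgue_on {0..1})) (PiM UNIV (\<lambda>_. borel)) (\<lambda>x. x) = PiM UNIV (\<lambda>_. unif)"
  using distr_PiM_map[OF prob_space_lebesgue_on_unit measurable_ident_lebesgue_on_borel]
  by (simp add: unif_def)

text \<open>\<open>V\<close> is measurable for a product of Lebesgue sigma-algebras and need not be
  Borel. It is measurable for the completion of the Borel product measure, so it contains a Borel
  set of the same measure, to which inner regularity applies.\<close>

lemma exists_compact_subset_of_positive_measure:
  assumes V: "V \<in> sets (PiM UNIV (\<lambda>_ :: nat. lebesgue_on {0..1}))"
    and pos: "0 < emeasure (PiM UNIV (\<lambda>_. lebesgue_on {0..1})) V"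
  shows "\<exists>K\<subseteq>V. compact K \<and> 0 < emeasure (PiM UNIV (\<lambda>_. unif)) K"
proof -
  let ?Q = "PiM UNIV (\<lambda>_ :: nat. lebesgue_on {0..1::real})"
  let ?R = "PiM UNIV (\<lambda>_ :: nat. unif)"
  let ?C = "UNIV \<rightarrow>\<^sub>E {0..1::real} :: (nat \<Rightarrow> real) set"
  interpret U: prob_space unif by (rule prob_space_unif)
  interpret R: product_prob_space "\<lambda>_. unif" "UNIV :: nat set" ..
  have spaceQ: "space ?Q = ?C" by (simp add: space_PiM)
  have meas: "(\<lambda>x. x) \<in> ?Q \<rightarrow>\<^sub>M PiM UNIV (\<lambda>_. borel)"
    by (intro measurable_PiM_single' measurable_compose[OF _ measurable_ident_lebesgue_on_borel] measurable_component_singleton)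
       (auto simp: space_PiM)
  have QR: "emeasure ?Q (A \<inter> ?C) = emeasure ?R A" if "A \<in> sets borel" for A
    using that by (subst distr_PiM_lebesgue_on_eq_unif[symmetric], subst emeasure_distr[OF meas])
      (simp_all add: sets_PiM_equal_borel space_PiM)
  have CR: "?C \<in> sets (completion ?R)"
    by (intro sets_completionI_sets, unfold sets_PiM_unif, subst sets_PiM_equal_borel[symmetric])
       (auto intro!: sets_PiM_I_countable)
  \<comment> \<open>Coordinates remain measurable for Lebesgue sets because a Lebesgue null set
    pulls back to a null set of the product.\<close>
  have comp: "(\<lambda>x. x i) \<in> completion ?R \<rightarrow>\<^sub>M lebesgue" for i
  proof (rule completion.measurable_completion2)
    have mR: "(\<lambda>x. x i) \<in> ?R \<rightarrow>\<^sub>M lborel"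
      using measurable_component_singleton[of i UNIV "\<lambda>_. unif"] by simp
    then show "(\<lambda>x. x i) \<in> completion ?R \<rightarrow>\<^sub>M lborel"
      by (rule measurable_completion)
    show "null_sets lborel \<subseteq> null_sets (distr (completion ?R) lborel (\<lambda>x. x i))"
    proof
      fix A :: "real set" assume A: "A \<in> null_sets lborel"
      then have AB: "A \<in> sets borel" by (auto simp: null_sets_def)
      have "emeasure lborel (A \<inter> {0..1}) = 0"
        using null_set_Int2[OF A, of "{0..1}"] by (auto simp: Int_commute)
      then have "emeasure ?R {x \<in> space ?R. x i \<in> A} = 0"
        using A by (subst R.emeasure_PiM_Collect_single) (auto simp: emeasure_unif)
      moreover have "{x \<in> space ?R. x i \<in> A} = (\<lambda>x. x i) -` A \<inter> space ?R" by auto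
      ultimately have "(\<lambda>x. x i) -` A \<inter> space ?R \<in> null_sets ?R"
        using measurable_sets[OF mR, of A] AB by (simp add: null_sets_def)
      then show "A \<in> null_sets (distr (completion ?R) lborel (\<lambda>x. x i))"
        using AB by (simp add: distr_completion[OF mR] null_sets_distr_iff[OF mR])
    qed
  qed
  have "(\<lambda>x. x) \<in> restrict_space (completion ?R) ?C \<rightarrow>\<^sub>M ?Q"
  proof (rule measurable_PiM_single')
    show "(\<lambda>x. x i) \<in> restrict_space (completion ?R) ?C \<rightarrow>\<^sub>M lebesgue_on {0..1}" for i
      using comp[of i] by (intro measurable_restrict_space3) auto
  qed (auto simp: space_restrict_space)
  from measurable_sets[OF this V] have "V \<inter> ?C \<in> sets (restrict_space (completion ?R) ?C)"
    by (simp add: space_restrict_space space_PiM)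
  then have "V \<inter> ?C \<in> sets (completion ?R)"
    using CR by (auto simp: sets_restrict_space)
  moreover have VC: "V \<inter> ?C = V"
    using sets.sets_into_space[OF V] spaceQ by auto
  ultimately obtain S N N' where SN: "V = S \<union> N" "N \<subseteq> N'" "N' \<in> null_sets ?R" "S \<in> sets ?R"
    using sets_completionE[of V ?R] by metis
  \<comment> \<open>The null set \<open>N'\<close> covers the possibly non-Borel remainder
    \<open>N\<close>, so the positive measure of \<open>V\<close> passes to
    \<open>S\<close>.\<close>
  have "emeasure ?Q V \<le> emeasure ?Q ((S \<union> N') \<inter> ?C)"
  proof (rule emeasure_mono)
    show "(S \<union> N') \<inter> ?C \<in> sets ?Q"
    proof -
      have "S \<union> N' \<in> sets (PiM UNIV (\<lambda>_. borel))"
        using SN by (simp add: sets_PiM_equal_borel sets_PiM_unif null_sets_def sets.Un)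
      then show ?thesis
        using measurable_sets[OF meas, of "S \<union> N'"] by (simp add: space_PiM)
    qed
  qed (use SN VC in auto)
  also have "\<dots> = emeasure ?R (S \<union> N')"
    using SN by (intro QR) (auto simp: sets_PiM_unif)
  also have "\<dots> = emeasure ?R S"
    using SN by (intro emeasure_Un_null_set) auto
  finally have "0 < emeasure ?R S" using pos by auto
  also have "emeasure ?R S = (SUP K \<in> {K. K \<subseteq> S \<and> compact K}. emeasure ?R K)"
    using SN by (intro inner_regular) (auto simp: sets_PiM_unif)
  finally obtain K where "K \<subseteq> S" "compact K" "0 < emeasure ?R K"
    by (auto simp: less_SUP_iff)
  then show ?thesis using SN by auto
qed

text \<open>The second property says that the chosen sequences have full outer measure. Only compact
  sets need to be met, and the reals suffice to index these.\<close>

lemma exists_disjoint_sequences_meeting_positive_sets: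
  includes cardinal_syntax
  obtains u :: "real \<Rightarrow> nat \<Rightarrow> real" where
    "\<And>\<xi> \<eta>. \<xi> \<noteq> \<eta> \<Longrightarrow> range (u \<xi>) \<inter> range (u \<eta>) = {}"
    "\<And>V. V \<in> sets (PiM UNIV (\<lambda>_. lebesgue_on {0..1})) \<Longrightarrow>
      0 < emeasure (PiM UNIV (\<lambda>_. lebesgue_on {0..1})) V \<Longrightarrow> \<exists>\<xi>. u \<xi> \<in> V"
proof -
  let ?Q = "PiM UNIV (\<lambda>_ :: nat. lebesgue_on {0..1::real})"
  let ?R = "PiM UNIV (\<lambda>_ :: nat. unif)"
  interpret Q: prob_space ?Q by (intro prob_space_PiM prob_space_lebesgue_on_unit)
  define \<K> where "\<K> = {K. compact K \<and> 0 < emeasure ?R K}"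
  have "\<K> \<lesssim> {K :: (nat \<Rightarrow> real) set. closed K}"
    by (rule subset_imp_lepoll) (auto simp: \<K>_def compact_imp_closed)
  also have "\<dots> \<lesssim> (UNIV :: real set)" by (rule closed_sets_lepoll_reals)
  finally obtain g :: "real \<Rightarrow> (nat \<Rightarrow> real) set" where g: "\<K> \<subseteq> range g"
    unfolding lepoll_iff by auto
  have "\<exists>K. K \<in> \<K>"
    using exists_compact_subset_of_positive_measure[of "space ?Q"] Q.emeasure_space_1
    by (auto simp: \<K>_def)
  then obtain K0 where K0: "K0 \<in> \<K>" ..
  \<comment> \<open>\<open>g\<close> may also take values outside \<open>\<K>\<close>; at those
    indices \<open>K0\<close> is used instead.\<close>
  define \<kappa> where "\<kappa> \<xi> = (if g \<xi> \<in> \<K> then g \<xi> else K0)" for \<xi>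
  have \<kappa>: "\<kappa> \<xi> \<in> \<K>" for \<xi> using K0 by (simp add: \<kappa>_def)
  have "\<exists>v\<in>\<kappa> \<xi>. range v \<inter> P = {}" if "|P| <o |UNIV :: real set|" for \<xi> P
    using \<kappa>[of \<xi>] that
    by (intro exists_avoiding_point) (auto simp: \<K>_def intro: borel_compact)
  then obtain u where u: "\<And>\<xi>. u \<xi> \<in> \<kappa> \<xi>" "\<And>\<xi> \<eta>. \<xi> \<noteq> \<eta> \<Longrightarrow> range (u \<xi>) \<inter> range (u \<eta>) = {}"
    by (rule transfinite_disjoint_selection[of \<kappa>]) blast+
  show thesis
  proof (rule that[OF u(2)])
    fix V assume "V \<in> sets ?Q" "0 < emeasure ?Q V"
    then obtain K where K: "K \<subseteq> V" "K \<in> \<K>"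
      using exists_compact_subset_of_positive_measure[of V] by (auto simp: \<K>_def)
    then obtain \<xi> where "K = g \<xi>" using g by blast
    then have "\<kappa> \<xi> = K" using K by (simp add: \<kappa>_def)
    then show "\<exists>\<xi>. u \<xi> \<in> V" using u(1)[of \<xi>] K by blast
  qed
qed

section \<open>The function and its McShane integral\<close>

text \<open>When the ranges are disjoint, each value is zero or the indicator of a single
  coordinate. The coordinatewise form avoids choosing that coordinate.\<close>

definition class_indicator :: "(real \<Rightarrow> nat \<Rightarrow> real) \<Rightarrow> real \<Rightarrow> linf_continuum" where
  "class_indicator u t = Bcontfun (\<lambda>\<xi>. indicator (range (u (of_discrete \<xi>))) t)"

lemma apply_class_indicator:
  "apply_bcontfun (class_indicator u t) \<xi> = indicator (range (u (of_discrete \<xi>))) t"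
proof -
  have "(\<lambda>\<xi>. indicat_real (range (u (of_discrete \<xi>))) t) \<in> bcontfun"
    by (rule bcontfun_normI[where b = 1])
      (auto simp: continuous_on_open_vimage open_discrete indicator_def)
  then show ?thesis by (simp add: class_indicator_def Bcontfun_inverse)
qed

lemma norm_class_indicator: "norm (class_indicator u t) \<le> 1"
  by (rule norm_bound) (simp add: apply_class_indicator indicator_def)

lemma bounded_linear_apply_bcontfun:
  "bounded_linear (\<lambda>f :: 'a :: topological_space \<Rightarrow>\<^sub>C 'b :: real_normed_vector. apply_bcontfun f x)"
  by (rule bounded_linear_intro[where K = 1]) (simp_all add: norm_bounded)

lemma apply_bcontfun_sum:
  fixes f :: "'i \<Rightarrow> 'a :: topological_space \<Rightarrow>\<^sub>C 'b :: real_normed_vector"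
  shows "apply_bcontfun (\<Sum>i\<in>I. f i) x = (\<Sum>i\<in>I. apply_bcontfun (f i) x)"
  using linear_sum[OF bounded_linear.linear[OF bounded_linear_apply_bcontfun]] .

lemma AE_lebesgue_on_countable:
  assumes "countable C"
  shows "AE x in lebesgue_on {0..1::real}. x \<notin> C"
proof -
  have "AE x in lebesgue. x \<notin> C"
    using AE_not_in[OF countable_imp_null_set_lborel[OF assms]] by (rule AE_completion)
  then show ?thesis by (subst AE_restrict_space_iff) (auto elim: eventually_mono)
qed

text \<open>In coordinate \<open>\<xi>\<close> a Riemann sum is the total length of the intervals
  tagged by terms of \<open>u \<xi>\<close>. These lie in balls of total length
  \<open>\<epsilon>\<close>, a bound independent of \<open>\<xi>\<close> and hence valid for the
  supremum norm.\<close>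

lemma has_mcshane_integral_class_indicator:
  assumes disj: "\<And>\<xi> \<eta>. \<xi> \<noteq> \<eta> \<Longrightarrow> range (u \<xi>) \<inter> range (u \<eta>) = {}"
  shows "has_mcshane_integral (class_indicator u) 0"
  unfolding has_mcshane_integral_def
proof (intro allI impI)
  fix \<epsilon> :: real assume \<epsilon>: "0 < \<epsilon>"
  \<comment> \<open>A sequence may repeat a term, so one index is chosen. Where no sequence takes
    the value \<open>t\<close>, the index is arbitrary, which is harmless because the function
    vanishes there.\<close>
  define idx where "idx t = (SOME k. \<exists>\<xi>. u \<xi> k = t)" for t
  have idx: "u \<xi> (idx t) = t" if t: "t \<in> range (u \<xi>)" for t \<xi>
  proof -
    have "\<exists>\<eta>. u \<eta> (idx t) = t"
      unfolding idx_def by (rule someI_ex) (use t in blast)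
    then obtain \<eta> where \<eta>: "u \<eta> (idx t) = t" ..
    then have "t \<in> range (u \<eta>)" by (metis rangeI)
    with t disj[of \<xi> \<eta>] have "\<eta> = \<xi>" by blast
    with \<eta> show ?thesis by simp
  qed
  \<comment> \<open>The ball of radius \<open>r k\<close> has length
    \<open>\<epsilon> * (1/2) ^ Suc k\<close>, and these lengths sum to
    \<open>\<epsilon>\<close>.\<close>
  define r where "r k = \<epsilon> * (1/2) ^ Suc k / 2" for k :: nat
  have r: "0 < r k" for k using \<epsilon> by (simp add: r_def)
  define \<delta> where "\<delta> t = r (idx t)" for t
  have bound: "(\<Sum>(a, b, t) \<leftarrow> p. (b - a) * indicator (range (u \<xi>)) t) \<le> \<epsilon>"
      and nonneg: "0 \<le> (\<Sum>(a, b, t) \<leftarrow> p. (b - a) * indicator (range (u \<xi>)) t)"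
    if p: "mcshane_partition p" "subordinate p \<delta>" for p \<xi>
  proof -
    define a where "a i = fst (p ! i)" for i
    define b where "b i = fst (snd (p ! i))" for i
    define t where "t i = snd (snd (p ! i))" for i
    have p_nth: "p ! i = (a i, b i, t i)" for i by (simp add: a_def b_def t_def)
    define I where "I = {i. i < length p \<and> t i \<in> range (u \<xi>)}"
    have mem: "(a i, b i, t i) \<in> set p" if "i < length p" for i
      using nth_mem[OF that] by (simp add: p_nth)
    have ab: "a i \<le> b i" if "i < length p" for i
    proof -
      have "\<forall>(a, b, t) \<in> set p. a \<le> b \<and> t \<in> {0..1}"
        using p(1) unfolding mcshane_partition_def by (rule conjunct1)
      from bspec[OF this mem[OF that]] show ?thesis by simp
    qed
    have sub: "t i - \<delta> (t i) \<le> a i" "b i \<le> t i + \<delta> (t i)" if "i < length p" for i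
      using bspec[OF p(2)[unfolded subordinate_def] mem[OF that]] by simp_all
    have eq: "(\<Sum>(a, b, t) \<leftarrow> p. (b - a) * indicator (range (u \<xi>)) t) = (\<Sum>i\<in>I. b i - a i)"
    proof -
      have "(\<Sum>(a, b, t) \<leftarrow> p. (b - a) * indicator (range (u \<xi>)) t)
          = (\<Sum>i = 0..<length p. (b i - a i) * indicator (range (u \<xi>)) (t i))"
        unfolding sum_list_sum_nth length_map
        by (rule sum.cong) (simp_all add: p_nth)
      also have "\<dots> = (\<Sum>i\<in>I. (b i - a i) * indicator (range (u \<xi>)) (t i))"
        by (rule sum.mono_neutral_right) (auto simp: I_def indicator_def)
      also have "\<dots> = (\<Sum>i\<in>I. b i - a i)"
        by (rule sum.cong) (auto simp: I_def)
      finally show ?thesis .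
    qed
    have finI: "finite I" by (simp add: I_def)
    \<comment> \<open>Non-overlapping intervals may share endpoints, so additivity is applied to the
      open intervals, which have the same lengths.\<close>
    have disj': "disjoint_family_on (\<lambda>i. {a i<..<b i}) I"
      unfolding disjoint_family_on_def
    proof (intro ballI impI)
      fix i j assume ij: "i \<in> I" "j \<in> I" "i \<noteq> j"
      then have "i < length p" "j < length p" by (auto simp: I_def)
      with ij(3) have "case p ! i of (a, b, _) \<Rightarrow> case p ! j of (c, d, _) \<Rightarrow>
           interior {a..b} \<inter> interior {c..d} = {}"
        using p(1)[unfolded mcshane_partition_def, THEN conjunct2, THEN conjunct1, rule_format, of i j] by simp
      then have "interior {a i..b i} \<inter> interior {a j..b j} = {}"
        by (simp only: p_nth prod.case)
      then show "{a i<..<b i} \<inter> {a j<..<b j} = {}" by simp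
    qed
    have "ennreal (\<Sum>i\<in>I. b i - a i) = (\<Sum>i\<in>I. emeasure lborel {a i<..<b i})"
      using ab by (subst sum_ennreal[symmetric]) (auto simp: I_def intro!: sum.cong)
    also have "\<dots> = emeasure lborel (\<Union>i\<in>I. {a i<..<b i})"
      using finI disj' by (intro sum_emeasure) auto
    also have "\<dots> \<le> emeasure lborel (\<Union>k. {u \<xi> k - r k..u \<xi> k + r k})"
    proof (rule emeasure_mono)
      show "(\<Union>i\<in>I. {a i<..<b i}) \<subseteq> (\<Union>k. {u \<xi> k - r k..u \<xi> k + r k})"
      proof
        fix x assume "x \<in> (\<Union>i\<in>I. {a i<..<b i})"
        then obtain i where i: "i < length p" "t i \<in> range (u \<xi>)" "a i < x" "x < b i"
          by (auto simp: I_def)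
        then have "x \<in> {u \<xi> (idx (t i)) - r (idx (t i))..u \<xi> (idx (t i)) + r (idx (t i))}"
          using sub[OF i(1)] idx[OF i(2)] by (simp add: \<delta>_def)
        then show "x \<in> (\<Union>k. {u \<xi> k - r k..u \<xi> k + r k})" by blast
      qed
    qed auto
    also have "\<dots> \<le> (\<Sum>k. emeasure lborel {u \<xi> k - r k..u \<xi> k + r k})"
      by (rule emeasure_subadditive_countably) auto
    also have "\<dots> = (\<Sum>k. ennreal (\<epsilon> * (1/2) ^ Suc k))"
    proof (rule suminf_cong)
      fix k
      have "u \<xi> k + r k - (u \<xi> k - r k) = \<epsilon> * (1/2) ^ Suc k" by (simp add: r_def)
      moreover have "u \<xi> k - r k \<le> u \<xi> k + r k" using r[of k] by linarith
      ultimately show "emeasure lborel {u \<xi> k - r k..u \<xi> k + r k} = ennreal (\<epsilon> * (1/2) ^ Suc k)"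
        by (simp only: emeasure_lborel_Icc)
    qed
    also have "\<dots> = ennreal \<epsilon>"
    proof (rule suminf_ennreal_eq)
      show "(\<lambda>k. \<epsilon> * (1/2) ^ Suc k) sums \<epsilon>"
        using sums_mult[OF power_half_series, of \<epsilon>] by (simp only: mult_1_right)
    qed (use \<epsilon> in simp)
    finally show "(\<Sum>(a, b, t) \<leftarrow> p. (b - a) * indicator (range (u \<xi>)) t) \<le> \<epsilon>"
      using \<epsilon> by (simp add: eq)
    show "0 \<le> (\<Sum>(a, b, t) \<leftarrow> p. (b - a) * indicator (range (u \<xi>)) t)"
      unfolding eq using ab by (intro sum_nonneg) (auto simp: I_def)
  qed
  have ev: "apply_bcontfun (\<Sum>(a, b, t) \<leftarrow> p. (b - a) *\<^sub>R class_indicator u t) \<xi>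
      = (\<Sum>(a, b, t) \<leftarrow> p. (b - a) * indicator (range (u (of_discrete \<xi>))) t)" for p \<xi>
    by (induction p) (auto simp: apply_class_indicator)
  show "\<exists>\<delta>. mcshane_gauge \<delta> \<and> (\<forall>p. mcshane_partition p \<and> subordinate p \<delta> \<longrightarrow>
      norm (0 - (\<Sum>(a, b, t)\<leftarrow>p. (b - a) *\<^sub>R class_indicator u t)) \<le> \<epsilon>)"
  proof (intro exI conjI allI impI)
    show "mcshane_gauge \<delta>" by (simp add: mcshane_gauge_def \<delta>_def r)
    fix p assume p: "mcshane_partition p \<and> subordinate p \<delta>"
    show "norm (0 - (\<Sum>(a, b, t)\<leftarrow>p. (b - a) *\<^sub>R class_indicator u t)) \<le> \<epsilon>"
      unfolding diff_0 norm_minus_cancel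
    proof (rule norm_bound)
      show "norm (apply_bcontfun (\<Sum>(a, b, t)\<leftarrow>p. (b - a) *\<^sub>R class_indicator u t) \<xi>) \<le> \<epsilon>" for \<xi>
        using bound[of p] nonneg[of p] p by (simp add: ev)
    qed
  qed
qed

section \<open>Failure of Talagrand integrability and of proper measurability\<close>

text \<open>Each coordinate of \<open>w\<close> is 0, with an exceptional null set depending on the
  coordinate. Norm convergence has a single exceptional null set \<open>N\<close>, and some
  \<open>u \<xi>\<close> lies outside it.\<close>

lemma not_talagrand_integrable_class_indicator:
  assumes meets: "\<And>V. V \<in> sets (PiM UNIV (\<lambda>_. lebesgue_on {0..1})) \<Longrightarrow>
      0 < emeasure (PiM UNIV (\<lambda>_. lebesgue_on {0..1})) V \<Longrightarrow> \<exists>\<xi>. u \<xi> \<in> V"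
  shows "\<not> talagrand_integrable (class_indicator u)"
proof
  let ?Q = "PiM UNIV (\<lambda>_ :: nat. lebesgue_on {0..1::real})"
  let ?avg = "\<lambda>s n. (1 / real n) *\<^sub>R (\<Sum>i<n. class_indicator u (s i))"
  interpret Q: prob_space ?Q by (intro prob_space_PiM prob_space_lebesgue_on_unit)
  assume "talagrand_integrable (class_indicator u)"
  then obtain w where w: "AE s in ?Q. ?avg s \<longlonglongrightarrow> w"
    unfolding talagrand_integrable_def has_talagrand_integral_def by blast
  have ev: "apply_bcontfun (?avg s n) \<xi> = (\<Sum>i<n. indicator (range (u (of_discrete \<xi>))) (s i)) / real n" for s n \<xi>
    by (simp add: apply_bcontfun_sum apply_class_indicator)
  have lim: "(\<lambda>n. apply_bcontfun (?avg s n) \<xi>) \<longlonglongrightarrow> apply_bcontfun w \<xi>" if "?avg s \<longlonglongrightarrow> w" for s \<xi>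
    by (rule bounded_linear.tendsto[OF bounded_linear_apply_bcontfun that])
  have w0: "apply_bcontfun w \<xi> = 0" for \<xi>
  proof -
    have "AE s in ?Q. \<forall>i. s i \<notin> range (u (of_discrete \<xi>))"
      unfolding AE_all_countable
      by (intro allI AE_PiM_component prob_space_lebesgue_on_unit AE_lebesgue_on_countable) auto
    with w have "AE s in ?Q. apply_bcontfun w \<xi> = 0"
    proof eventually_elim
      case (elim s)
      then show ?case using lim[OF elim(1), of \<xi>] unfolding ev by (simp add: LIMSEQ_const_iff)
    qed
    then show ?thesis by simp
  qed
  from w obtain N where N: "N \<in> null_sets ?Q" "{s \<in> space ?Q. \<not> ?avg s \<longlonglongrightarrow> w} \<subseteq> N"
    by (auto simp: eventually_ae_filter)
  have "0 < emeasure ?Q (space ?Q - N)"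
    using N(1) by (simp add: emeasure_Diff_null_set Q.emeasure_space_1)
  then obtain \<xi> where "u \<xi> \<in> space ?Q - N"
    using meets[of "space ?Q - N"] N(1) by auto
  then have "?avg (u \<xi>) \<longlonglongrightarrow> w" using N(2) by blast
  from lim[OF this, of "discrete \<xi>"]
  have "(\<lambda>n. (\<Sum>i<n. 1) / real n) \<longlonglongrightarrow> 0"
    unfolding ev w0 by (simp add: discrete_inverse)
  \<comment> \<open>The quotient is 1 only from \<open>n = 1\<close> on; at 0 division by zero gives
    0.\<close>
  moreover have "(\<lambda>n. (\<Sum>i<n. 1) / real n) \<longlonglongrightarrow> 1"
    by (rule tendsto_eventually) (auto intro!: eventually_sequentiallyI[of 1])
  ultimately have "(0::real) = 1" by (rule LIMSEQ_unique)
  then show False by simp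
qed

text \<open>Stability would enclose the separated pairs in a measurable set of measure below 1. By
  Fubini it has deficient sections over a set of positive measure, which contains an initial segment
  of some \<open>u \<xi>\<close>.\<close>

lemma not_properly_measurable_class_indicator:
  assumes meets: "\<And>V. V \<in> sets (PiM UNIV (\<lambda>_. lebesgue_on {0..1})) \<Longrightarrow>
      0 < emeasure (PiM UNIV (\<lambda>_. lebesgue_on {0..1})) V \<Longrightarrow> \<exists>\<xi>. u \<xi> \<in> V"
  shows "\<not> properly_measurable (lebesgue_on {0..1}) (class_indicator u)"
proof
  let ?M = "lebesgue_on {0..1::real}"
  let ?A = "{blinfun_apply h \<circ> class_indicator u | h :: linf_continuum \<Rightarrow>\<^sub>L real. norm h \<le> 1}"
  assume "properly_measurable ?M (class_indicator u)"
  then have st: "stable ?M ?A" by (simp add: properly_measurable_def)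
  interpret M: prob_space ?M by (rule prob_space_lebesgue_on_unit)
  have E1: "emeasure ?M {0..1} = 1" using M.emeasure_space_1 by simp
  \<comment> \<open>The levels 0 and 1 are the two values taken by the coordinates of the
    function.\<close>
  obtain m n where "outer_measure_of (PiM {..<m} (\<lambda>_. ?M) \<Otimes>\<^sub>M PiM {..<n} (\<lambda>_. ?M)) (Zset ?A {0..1} m n 0 1)
      < emeasure ?M {0..1} ^ (m + n)"
    using st[unfolded stable_def, rule_format, of "{0..1}" 0 1] E1 by auto
  then have less: "outer_measure_of (PiM {..<m} (\<lambda>_. ?M) \<Otimes>\<^sub>M PiM {..<n} (\<lambda>_. ?M)) (Zset ?A {0..1} m n 0 1) < 1"
    by (simp add: E1)
  let ?P = "PiM {..<m} (\<lambda>_. ?M)" and ?N = "PiM {..<n} (\<lambda>_. ?M)" and ?Q = "PiM UNIV (\<lambda>_ :: nat. ?M)"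
  interpret P: prob_space ?P by (intro prob_space_PiM prob_space_lebesgue_on_unit)
  interpret N: prob_space ?N by (intro prob_space_PiM prob_space_lebesgue_on_unit)
  interpret PN: pair_prob_space ?P ?N ..
  from less obtain W where W: "W \<in> sets (?P \<Otimes>\<^sub>M ?N)" "Zset ?A {0..1} m n 0 1 \<subseteq> W" "emeasure (?P \<Otimes>\<^sub>M ?N) W < 1"
    unfolding outer_measure_of_def by (auto simp: INF_less_iff)
  \<comment> \<open>For \<open>v\<close> the initial segment of some \<open>u \<xi>\<close>, almost every \<open>t\<close> avoids the countable set \<open>range (u \<xi>)\<close>,
    so the section of \<open>W\<close> at \<open>v\<close> has full measure.\<close>
  define B where "B = {v \<in> space ?N. emeasure ?P ((\<lambda>t. (t, v)) -` W) \<noteq> 1}"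
  have B [measurable]: "B \<in> sets ?N"
    unfolding B_def using PN.measurable_emeasure_Pair2[OF W(1)] by measurable
  have "emeasure ?N B \<noteq> 0"
  proof
    assume "emeasure ?N B = 0"
    then have "AE v in ?N. emeasure ?P ((\<lambda>t. (t, v)) -` W) = 1"
      using B by (intro AE_I[of _ _ B]) (auto simp: B_def)
    then have "(\<integral>\<^sup>+ v. emeasure ?P ((\<lambda>t. (t, v)) -` W) \<partial>?N) = (\<integral>\<^sup>+ v. 1 \<partial>?N)"
      by (rule nn_integral_cong_AE)
    then show False
      using W(3) N.emeasure_space_1 by (simp add: PN.emeasure_pair_measure_alt2[OF W(1)])
  qed
  \<comment> \<open>The first \<open>n\<close> terms of a random sequence have distribution
    \<open>?N\<close>, so \<open>B\<close> pulls back to a set of sequences of positive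
    measure.\<close>
  let ?f = "\<lambda>s. restrict s {..<n}"
  have f: "?f \<in> ?Q \<rightarrow>\<^sub>M ?N" by (rule measurable_restrict_subset) simp
  have "emeasure ?Q (?f -` B \<inter> space ?Q) = emeasure (distr ?Q ?N ?f) B"
    using B by (simp add: emeasure_distr[OF f])
  also have "distr ?Q ?N ?f = ?N"
    using distr_PiM_reindex[of UNIV "\<lambda>_. ?M" "\<lambda>i. i" "{..<n}"] prob_space_lebesgue_on_unit by simp
  finally have "0 < emeasure ?Q (?f -` B \<inter> space ?Q)"
    using \<open>emeasure ?N B \<noteq> 0\<close> by (simp only: zero_less_iff_neq_zero not_False_eq_True)
  then obtain \<xi> where \<xi>: "?f (u \<xi>) \<in> B"
    using meets[of "?f -` B \<inter> space ?Q"] measurable_sets[OF f B] by auto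
  let ?v = "?f (u \<xi>)"
  have vN: "?v \<in> space ?N" using \<xi> by (simp add: B_def)
  \<comment> \<open>Evaluation at coordinate \<open>\<xi>\<close> turns the function into the
    indicator of \<open>range (u \<xi>)\<close>, which is 1 on the terms of \<open>?v\<close> and 0
    off the range.\<close>
  define h where "h = Blinfun (\<lambda>f :: linf_continuum. apply_bcontfun f (discrete \<xi>))"
  have h: "blinfun_apply h f = apply_bcontfun f (discrete \<xi>)" for f
    by (simp add: h_def bounded_linear_Blinfun_apply bounded_linear_apply_bcontfun)
  have "norm h \<le> 1"
    by (rule norm_blinfun_bound) (simp_all add: h norm_bounded del: real_norm_def)
  then have hA: "blinfun_apply h \<circ> class_indicator u \<in> ?A" by blast
  have ht: "(blinfun_apply h \<circ> class_indicator u) x = indicator (range (u \<xi>)) x" for x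
    by (simp add: h apply_class_indicator discrete_inverse)
  have "AE t in ?P. \<forall>i\<in>{..<m}. t i \<notin> range (u \<xi>)"
    by (intro AE_finite_allI AE_PiM_component prob_space_lebesgue_on_unit AE_lebesgue_on_countable) auto
  then have "AE t in ?P. t \<in> (\<lambda>t. (t, ?v)) -` W"
  proof (rule AE_mp, intro AE_I2 impI)
    fix t assume t: "t \<in> space ?P" "\<forall>i\<in>{..<m}. t i \<notin> range (u \<xi>)"
    have "(t, ?v) \<in> Zset ?A {0..1} m n 0 1"
    proof -
      have "\<exists>f\<in>?A. (\<forall>i<m. f (t i) \<le> 0) \<and> (\<forall>j<n. f (?v j) \<ge> 1)"
      proof (rule bexI)
        show "blinfun_apply h \<circ> class_indicator u \<in> ?A" by (rule hA)
      qed (use t in \<open>simp only: ht, simp\<close>)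
      then show ?thesis
        unfolding Zset_def using t vN by (simp only: space_PiM) simp
    qed
    with W(2) show "t \<in> (\<lambda>t. (t, ?v)) -` W" by auto
  qed
  then have "emeasure ?P ((\<lambda>t. (t, ?v)) -` W) = 1"
    using sets_Pair2[OF W(1), of ?v] by (intro P.emeasure_eq_1_AE) auto
  with \<xi> show False by (simp add: B_def)
qed

theorem mainTheorem4:
  shows "\<exists>\<phi> :: real \<Rightarrow> linf_continuum.
    bounded (\<phi> ` {0..1}) \<and>
    mcshane_integrable \<phi> \<and>
    \<not> properly_measurable (lebesgue_on {0..1}) \<phi> \<and>
    \<not> talagrand_integrable \<phi>"
proof -
  obtain u :: "real \<Rightarrow> nat \<Rightarrow> real" where u:
    "\<And>\<xi> \<eta>. \<xi> \<noteq> \<eta> \<Longrightarrow> range (u \<xi>) \<inter> range (u \<eta>) = {}"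
    "\<And>V. V \<in> sets (PiM UNIV (\<lambda>_. lebesgue_on {0..1})) \<Longrightarrow>
      0 < emeasure (PiM UNIV (\<lambda>_. lebesgue_on {0..1})) V \<Longrightarrow> \<exists>\<xi>. u \<xi> \<in> V"
    by (rule exists_disjoint_sequences_meeting_positive_sets) blast
  show ?thesis
  proof (intro exI conjI)
    show "bounded (class_indicator u ` {0..1})"
      by (auto simp: bounded_iff intro!: exI[of _ 1] norm_class_indicator)
    show "mcshane_integrable (class_indicator u)"
      unfolding mcshane_integrable_def using has_mcshane_integral_class_indicator[where u = u, OF u(1)] by blast
    show "\<not> properly_measurable (lebesgue_on {0..1}) (class_indicator u)"
      by (rule not_properly_measurable_class_indicator[OF u(2)])
    show "\<not> talagrand_integrable (class_indicator u)"
      by (rule not_talagrand_integrable_class_indicator[OF u(2)])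
  qed
qed

end
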